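(* Let $\{\phi_i\}_{i=1}^\infty$ be a Riesz basis for $\ell^2$ which does norm retrieval in $\ell^2$. Then the vectors $\{\phi_i\}_{i=1}^\infty$ are orthogonal, i.e. $\langle \phi_i,\phi_j\rangle = 0$ for all $i\neq j$.
   Context: $\ell^2$ is the real Hilbert space of square-summable real sequences. A family $\{\phi_i\}_{i=1}^\infty$ in $\ell^2$ is a Riesz sequence if there are constants $0<A\le B<\infty$ with $A\sum_i |c_i|^2 \le \|\sum_i c_i\phi_i\|^2 \le B\sum_i|c_i|^2$ for all (square-summable) sequences of scalars $\{c_i\}$; it is a Riesz basis if in addition it is complete in $\ell^2$ (its closed linear span is $\ell^2$). A family $\{f_i\}_{i=1}^\infty$ in $\ell^2$ does norm retrieval if whenever $x,y\in\ell^2$ satisfy $|\langle x,f_i\rangle| = |\langle y,f_i\rangle|$ for all $i$, then $\|x\|=\|y\|$. *)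

theory Defs
  imports "HOL-Analysis.Analysis"
begin

section \<open>The real Hilbert space of square-summable sequences\<close>

lemma summable_mult_of_square_summable:
  fixes x y :: "nat \<Rightarrow> real"
  assumes "summable (\<lambda>k. (x k)\<^sup>2)" "summable (\<lambda>k. (y k)\<^sup>2)"
  shows "summable (\<lambda>k. x k * y k)"
proof (rule summable_comparison_test')
  show "summable (\<lambda>k. (x k)\<^sup>2 + (y k)\<^sup>2)"
    by (intro summable_add assms)
  fix k :: nat
  have "2 * (\<bar>x k\<bar> * \<bar>y k\<bar>) \<le> (x k)\<^sup>2 + (y k)\<^sup>2"
    using sum_squares_bound[of "\<bar>x k\<bar>" "\<bar>y k\<bar>"] by simp
  moreover have "0 \<le> \<bar>x k\<bar> * \<bar>y k\<bar>" by simp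
  ultimately show "norm (x k * y k) \<le> (x k)\<^sup>2 + (y k)\<^sup>2"
    by (simp only: real_norm_def abs_mult)
qed

lemma square_summable_add:
  fixes x y :: "nat \<Rightarrow> real"
  assumes "summable (\<lambda>k. (x k)\<^sup>2)" "summable (\<lambda>k. (y k)\<^sup>2)"
  shows "summable (\<lambda>k. (x k + y k)\<^sup>2)"
proof -
  have "summable (\<lambda>k. (x k)\<^sup>2 + (y k)\<^sup>2 + 2 * (x k * y k))"
    by (intro summable_add summable_mult summable_mult_of_square_summable assms)
  then show ?thesis by (simp add: power2_sum mult.assoc)
qed

lemma square_summable_scale:
  fixes x :: "nat \<Rightarrow> real"
  assumes "summable (\<lambda>k. (x k)\<^sup>2)"
  shows "summable (\<lambda>k. (r * x k)\<^sup>2)"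
  using summable_mult[OF assms, of "r\<^sup>2"] by (simp add: power_mult_distrib)

typedef ell2 = "{x :: nat \<Rightarrow> real. summable (\<lambda>k. (x k)\<^sup>2)}"
  morphisms ell2_nth Abs_ell2
  by (rule exI[of _ "\<lambda>_. 0"]) simp

setup_lifting type_definition_ell2

instantiation ell2 :: real_vector
begin

lift_definition zero_ell2 :: ell2 is "\<lambda>_. 0" by simp

lift_definition plus_ell2 :: "ell2 \<Rightarrow> ell2 \<Rightarrow> ell2" is "\<lambda>x y k. x k + y k"
  by (rule square_summable_add)

lift_definition scaleR_ell2 :: "real \<Rightarrow> ell2 \<Rightarrow> ell2" is "\<lambda>r x k. r * x k"
  by (rule square_summable_scale)

lift_definition uminus_ell2 :: "ell2 \<Rightarrow> ell2" is "\<lambda>x k. - x k" by simp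

lift_definition minus_ell2 :: "ell2 \<Rightarrow> ell2 \<Rightarrow> ell2" is "\<lambda>x y k. x k - y k"
proof -
  fix x y :: "nat \<Rightarrow> real"
  assume "summable (\<lambda>k. (x k)\<^sup>2)" "summable (\<lambda>k. (y k)\<^sup>2)"
  then show "summable (\<lambda>k. (x k - y k)\<^sup>2)"
    using square_summable_add[of x "\<lambda>k. - y k"] by simp
qed

instance
  by standard (transfer; simp add: fun_eq_iff algebra_simps)+

end

instantiation ell2 :: real_inner
begin

lift_definition inner_ell2 :: "ell2 \<Rightarrow> ell2 \<Rightarrow> real" is "\<lambda>x y. \<Sum>k. x k * y k" .

definition norm_ell2 :: "ell2 \<Rightarrow> real"
  where "norm_ell2 x = sqrt (inner x x)"

definition sgn_ell2 :: "ell2 \<Rightarrow> ell2"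
  where "sgn_ell2 x = x /\<^sub>R norm x"

definition dist_ell2 :: "ell2 \<Rightarrow> ell2 \<Rightarrow> real"
  where "dist_ell2 x y = norm (x - y)"

definition uniformity_ell2 :: "(ell2 \<times> ell2) filter"
  where "uniformity_ell2 = (INF e\<in>{0<..}. principal {(x, y). dist x y < e})"

definition open_ell2 :: "ell2 set \<Rightarrow> bool"
  where "open_ell2 U = (\<forall>x\<in>U. \<forall>\<^sub>F (x', y) in uniformity. x' = x \<longrightarrow> y \<in> U)"

instance
proof
  fix x y z :: ell2 and r :: real and U :: "ell2 set"
  show "dist x y = norm (x - y)" by (rule dist_ell2_def)
  show "sgn x = x /\<^sub>R norm x" by (rule sgn_ell2_def)
  show "uniformity = (INF e\<in>{0<..}. principal {(x::ell2, y). dist x y < e})"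
    by (rule uniformity_ell2_def)
  show "open U = (\<forall>x\<in>U. \<forall>\<^sub>F (x', y) in uniformity. x' = x \<longrightarrow> y \<in> U)"
    by (rule open_ell2_def)
  show "norm x = sqrt (inner x x)" by (rule norm_ell2_def)
  show "inner x y = inner y x"
    by transfer (simp add: mult.commute)
  show "inner (x + y) z = inner x z + inner y z"
    by transfer
      (simp add: distrib_right suminf_add summable_mult_of_square_summable)
  show "inner (r *\<^sub>R x) y = r * inner x y"
    by transfer (simp add: mult.assoc suminf_mult summable_mult_of_square_summable)
  show "0 \<le> inner x x"
    by transfer (simp add: suminf_nonneg summable_mult_of_square_summable)
  show "inner x x = 0 \<longleftrightarrow> x = 0"
    by transfer (simp add: suminf_eq_zero_iff summable_mult_of_square_summable fun_eq_iff)
qed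

end

lemma ell2_square_summable: "summable (\<lambda>k. (ell2_nth x k)\<^sup>2)"
  using ell2_nth[of x] by simp

lemma ell2_norm_power2: "(norm x)\<^sup>2 = (\<Sum>k. (ell2_nth x k)\<^sup>2)"
  unfolding power2_norm_eq_inner inner_ell2.rep_eq by (simp add: power2_eq_square)

lemma ell2_sum_le_norm: "(\<Sum>k<n. (ell2_nth x k)\<^sup>2) \<le> (norm x)\<^sup>2"
  unfolding ell2_norm_power2
  by (rule sum_le_suminf) (auto simp: ell2_square_summable)

lemma ell2_nth_le_norm: "\<bar>ell2_nth x k\<bar> \<le> norm x"
proof (rule power2_le_imp_le)
  have "(\<Sum>i\<in>{k}. (ell2_nth x i)\<^sup>2) \<le> (norm x)\<^sup>2"
    unfolding ell2_norm_power2
    by (rule sum_le_suminf) (auto simp: ell2_square_summable)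
  then show "\<bar>ell2_nth x k\<bar>\<^sup>2 \<le> (norm x)\<^sup>2" by simp
qed simp

instance ell2 :: banach
proof
  fix X :: "nat \<Rightarrow> ell2"
  assume X: "Cauchy X"
  have "Cauchy (\<lambda>n. ell2_nth (X n) k)" for k
  proof (rule CauchyI)
    fix e :: real
    assume "0 < e"
    then obtain M where M: "\<And>m n. m \<ge> M \<Longrightarrow> n \<ge> M \<Longrightarrow> norm (X m - X n) < e"
      using CauchyD[OF X] by blast
    have "norm (ell2_nth (X m) k - ell2_nth (X n) k) < e" if "m \<ge> M" "n \<ge> M" for m n
      using ell2_nth_le_norm[of "X m - X n" k] M[OF that]
      by (simp add: minus_ell2.rep_eq)
    then show "\<exists>M. \<forall>m\<ge>M. \<forall>n\<ge>M. norm (ell2_nth (X m) k - ell2_nth (X n) k) < e"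
      by blast
  qed
  then have "\<forall>k. \<exists>l. (\<lambda>n. ell2_nth (X n) k) \<longlonglongrightarrow> l"
    by (simp add: Cauchy_convergent_iff convergent_def)
  then obtain l where l: "\<And>k. (\<lambda>n. ell2_nth (X n) k) \<longlonglongrightarrow> l k"
    by metis
  have bound: "(\<Sum>k<K. (ell2_nth (X m) k - l k)\<^sup>2) \<le> e\<^sup>2"
    if "0 < e" and M: "\<And>n. n \<ge> M \<Longrightarrow> norm (X m - X n) < e" for e m M K
  proof (rule LIMSEQ_le_const2)
    show "(\<lambda>n. \<Sum>k<K. (ell2_nth (X m) k - ell2_nth (X n) k)\<^sup>2)
        \<longlonglongrightarrow> (\<Sum>k<K. (ell2_nth (X m) k - l k)\<^sup>2)"
      by (intro tendsto_intros l)
    have "(\<Sum>k<K. (ell2_nth (X m) k - ell2_nth (X n) k)\<^sup>2) \<le> e\<^sup>2" if "n \<ge> M" for n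
    proof -
      have "(norm (X m - X n))\<^sup>2 \<le> e\<^sup>2"
        using M[OF that] by (intro power_mono) auto
      then show ?thesis
        using ell2_sum_le_norm[of "X m - X n" K] by (simp add: minus_ell2.rep_eq)
    qed
    then show "\<exists>N. \<forall>n\<ge>N. (\<Sum>k<K. (ell2_nth (X m) k - ell2_nth (X n) k)\<^sup>2) \<le> e\<^sup>2"
      by blast
  qed
  have diff: "summable (\<lambda>k. (ell2_nth (X m) k - l k)\<^sup>2)"
      "(\<Sum>k. (ell2_nth (X m) k - l k)\<^sup>2) \<le> e\<^sup>2"
    if "0 < e" and M: "\<And>n. n \<ge> M \<Longrightarrow> norm (X m - X n) < e" for e m M
  proof -
    show 1: "summable (\<lambda>k. (ell2_nth (X m) k - l k)\<^sup>2)"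
      by (rule summableI_nonneg_bounded[OF _ bound[OF that]]) auto
    show "(\<Sum>k. (ell2_nth (X m) k - l k)\<^sup>2) \<le> e\<^sup>2"
      by (rule suminf_le_const[OF 1]) (rule bound[OF that])
  qed
  obtain M1 where "\<And>m n. m \<ge> M1 \<Longrightarrow> n \<ge> M1 \<Longrightarrow> norm (X m - X n) < 1"
    using CauchyD[OF X, of 1] by auto
  then have "summable (\<lambda>k. (ell2_nth (X M1) k - l k)\<^sup>2)"
    by (intro diff(1)[of 1 M1]) auto
  then have "summable (\<lambda>k. (- 1 * (ell2_nth (X M1) k - l k) + ell2_nth (X M1) k)\<^sup>2)"
    by (intro square_summable_add square_summable_scale ell2_square_summable)
  then have L: "ell2_nth (Abs_ell2 l) = l"
    by (intro Abs_ell2_inverse) simp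
  have "X \<longlonglongrightarrow> Abs_ell2 l"
  proof (rule LIMSEQ_I)
    fix e :: real
    assume "0 < e"
    then obtain M where M: "\<And>m n. m \<ge> M \<Longrightarrow> n \<ge> M \<Longrightarrow> norm (X m - X n) < e / 2"
      using CauchyD[OF X, of "e / 2"] by auto
    have "norm (X m - Abs_ell2 l) < e" if "m \<ge> M" for m
    proof -
      have "(norm (X m - Abs_ell2 l))\<^sup>2 \<le> (e / 2)\<^sup>2"
        unfolding ell2_norm_power2 minus_ell2.rep_eq L
        by (rule diff(2)[of "e / 2" M]) (use \<open>0 < e\<close> M that in simp_all)
      then have "norm (X m - Abs_ell2 l) \<le> e / 2"
        by (rule power2_le_imp_le) (use \<open>0 < e\<close> in simp)
      then show ?thesis using \<open>0 < e\<close> by simp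
    qed
    then show "\<exists>no. \<forall>n\<ge>no. norm (X n - Abs_ell2 l) < e" by blast
  qed
  then show "convergent X" by (rule convergentI)
qed


section \<open>Riesz bases and norm retrieval\<close>

text \<open>
  The defining inequality presupposes that the series converges in norm. This has to be
  said explicitly, because \<^const>\<open>suminf\<close> is a total function.
\<close>

definition riesz_sequence :: "(nat \<Rightarrow> ell2) \<Rightarrow> bool" where
  "riesz_sequence \<phi> \<longleftrightarrow>
    (\<exists>A B :: real. 0 < A \<and> A \<le> B \<and>
      (\<forall>c :: nat \<Rightarrow> real. summable (\<lambda>i. (c i)\<^sup>2) \<longrightarrow>
        summable (\<lambda>i. c i *\<^sub>R \<phi> i) \<and>
        A * (\<Sum>i. (c i)\<^sup>2) \<le> (norm (\<Sum>i. c i *\<^sub>R \<phi> i))\<^sup>2 \<and>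
        (norm (\<Sum>i. c i *\<^sub>R \<phi> i))\<^sup>2 \<le> B * (\<Sum>i. (c i)\<^sup>2)))"

definition riesz_basis :: "(nat \<Rightarrow> ell2) \<Rightarrow> bool" where
  "riesz_basis \<phi> \<longleftrightarrow> riesz_sequence \<phi> \<and> closure (span (range \<phi>)) = UNIV"

definition norm_retrieval :: "(nat \<Rightarrow> ell2) \<Rightarrow> bool" where
  "norm_retrieval f \<longleftrightarrow>
    (\<forall>x y. (\<forall>i. \<bar>inner x (f i)\<bar> = \<bar>inner y (f i)\<bar>) \<longrightarrow> norm x = norm y)"

end

theory Submission
  imports Defs
begin

text \<open>
  Since the distance from \<open>\<phi> j\<close> to the closed span of the other vectors is positive, projecting
  yields a \<open>\<psi>\<close> that is orthogonal to every \<open>\<phi> k\<close> with \<open>k \<noteq> j\<close> but not to \<open>\<phi> j\<close>. If \<open>u\<close> is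
  orthogonal to \<open>\<phi> j\<close>, then \<open>u + \<psi>\<close> and \<open>u - \<psi>\<close> have the same measurement moduli, so norm
  retrieval forces \<open>u\<close> to be orthogonal to \<open>\<psi>\<close>. Hence \<open>\<psi>\<close> is a multiple of \<open>\<phi> j\<close>.
\<close>

text \<open>A minimizing sequence is Cauchy by the parallelogram law: midpoints of its members stay
  in \<open>S\<close>, so they cannot come closer to \<open>x\<close> than the infimum
  \<open>d\<close>. Completeness gives a limit, and closedness keeps it in \<open>S\<close>.\<close>

lemma closed_subspace_nearest_point:
  fixes S :: "'a::{real_inner, complete_space} set"
  assumes S: "subspace S" "closed S"
  obtains p where "p \<in> S" "\<And>s. s \<in> S \<Longrightarrow> dist x p \<le> dist x s"
proof -
  define d where "d = infdist x S"
  have ne: "S \<noteq> {}" using subspace_0[OF S(1)] by auto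
  have d: "d \<le> dist x s" if "s \<in> S" for s
    unfolding d_def using that by (rule infdist_le)
  have d0: "0 \<le> d" unfolding d_def by (rule infdist_nonneg)
  \<comment> \<open>The error is measured on squared distances, so that it enters the parallelogram
    identity linearly.\<close>
  have "\<exists>s\<in>S. (dist x s)\<^sup>2 < d\<^sup>2 + inverse (real (Suc n))" for n
  proof -
    have "d < sqrt (d\<^sup>2 + inverse (real (Suc n)))"
      by (rule real_less_rsqrt) simp
    then obtain s where s: "s \<in> S" "dist x s < sqrt (d\<^sup>2 + inverse (real (Suc n)))"
      using cINF_less_iff[of S "dist x" "sqrt (d\<^sup>2 + inverse (real (Suc n)))"] ne
      unfolding d_def infdist_notempty[OF ne] by (auto intro: bdd_belowI[of _ 0])
    have "(dist x s)\<^sup>2 < (sqrt (d\<^sup>2 + inverse (real (Suc n))))\<^sup>2"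
      using s(2) by (intro power_strict_mono) auto
    with s(1) show ?thesis by (auto simp: add_nonneg_nonneg)
  qed
  then obtain s where s: "\<And>n. s n \<in> S"
      and s': "\<And>n. (dist x (s n))\<^sup>2 < d\<^sup>2 + inverse (real (Suc n))"
    by metis
  have par: "(dist (s m) (s n))\<^sup>2 < 2 * inverse (real (Suc m)) + 2 * inverse (real (Suc n))" for m n
  proof -
    have "(1 / 2) *\<^sub>R (s m + s n) \<in> S"
      using S(1) s by (intro subspace_scale subspace_add)
    then have "d\<^sup>2 \<le> (dist x ((1 / 2) *\<^sub>R (s m + s n)))\<^sup>2"
      using d d0 by (intro power_mono) auto
    \<comment> \<open>Parallelogram identity for \<open>x - s m\<close> and \<open>x - s n\<close>;
      the last term is at least \<open>4 * d\<^sup>2\<close>, which cancels both copies of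
      \<open>2 * d\<^sup>2\<close>.\<close>
    moreover have "(dist (s m) (s n))\<^sup>2 = 2 * (dist x (s m))\<^sup>2 + 2 * (dist x (s n))\<^sup>2
        - 4 * (dist x ((1 / 2) *\<^sub>R (s m + s n)))\<^sup>2"
      by (simp add: dist_norm power2_norm_eq_inner inner_diff_left inner_diff_right
          inner_add_left inner_add_right inner_commute)
        (simp add: field_simps)
    ultimately show ?thesis using s'[of m] s'[of n] by linarith
  qed
  have "Cauchy s"
  proof (rule metric_CauchyI)
    fix e :: real assume e: "0 < e"
    then obtain N where N: "inverse (real (Suc N)) < e\<^sup>2 / 4"
      using reals_Archimedean[of "e\<^sup>2 / 4"] by auto
    have "dist (s m) (s n) < e" if "m \<ge> N" "n \<ge> N" for m n
    proof -
      have le: "inverse (real (Suc k)) \<le> inverse (real (Suc N))" if "k \<ge> N" for k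
        using that by (intro le_imp_inverse_le) auto
      have "(dist (s m) (s n))\<^sup>2 < e\<^sup>2"
        using par[of m n] N le[OF that(1)] le[OF that(2)] by linarith
      then show ?thesis by (rule power2_less_imp_less) (use e in simp)
    qed
    then show "\<exists>M. \<forall>m\<ge>M. \<forall>n\<ge>M. dist (s m) (s n) < e" by blast
  qed
  then obtain p where p: "s \<longlonglongrightarrow> p"
    using Cauchy_convergent_iff convergent_def by blast
  have pS: "p \<in> S" using S(2) s p by (rule closed_sequentially)
  \<comment> \<open>The summand \<open>0\<close> is the limit of the error term, kept in the shape
    that the sum rule for limits produces.\<close>
  have "(dist x p)\<^sup>2 \<le> d\<^sup>2 + 0"
  proof (rule LIMSEQ_le)
    show "(\<lambda>n. (dist x (s n))\<^sup>2) \<longlonglongrightarrow> (dist x p)\<^sup>2"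
      by (intro tendsto_intros p)
    show "(\<lambda>n. d\<^sup>2 + inverse (real (Suc n))) \<longlonglongrightarrow> d\<^sup>2 + 0"
      by (intro tendsto_intros LIMSEQ_inverse_real_of_nat)
    show "\<exists>N. \<forall>n\<ge>N. (dist x (s n))\<^sup>2 \<le> d\<^sup>2 + inverse (real (Suc n))"
      using s' less_imp_le by blast
  qed
  then have "dist x p \<le> d" using d0 by (simp add: power2_le_iff_abs_le)
  with pS d show thesis using that order_trans by blast
qed

text \<open>First variation at the nearest point: if the residual had a component along some
  \<open>s\<close> in \<open>S\<close>, moving \<open>p\<close> in that direction would shorten
  it.\<close>

lemma orthogonal_projection_exists:
  fixes S :: "'a::{real_inner, complete_space} set"
  assumes S: "subspace S" "closed S"
  obtains p where "p \<in> S" "\<And>s. s \<in> S \<Longrightarrow> inner (x - p) s = 0"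
proof -
  obtain p where p: "p \<in> S" and min: "\<And>s. s \<in> S \<Longrightarrow> dist x p \<le> dist x s"
    using closed_subspace_nearest_point[OF S] by metis
  have "inner (x - p) s = 0" if s: "s \<in> S" for s
  proof (cases "s = 0")
    case False
    \<comment> \<open>The minimizer of the quadratic in \<open>t\<close> given by the squared norm
      of \<open>x - p - t *\<^sub>R s\<close>.\<close>
    define t where "t = inner (x - p) s / inner s s"
    have "p + t *\<^sub>R s \<in> S" using S(1) p s by (intro subspace_add subspace_scale)
    then have "(norm (x - p))\<^sup>2 \<le> (norm (x - p - t *\<^sub>R s))\<^sup>2"
      using min by (intro power_mono) (auto simp: dist_norm diff_diff_eq)
    also have "\<dots> = (norm (x - p))\<^sup>2 - 2 * t * inner (x - p) s + t\<^sup>2 * inner s s"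
      unfolding power2_norm_eq_inner
      by (simp add: inner_diff_left[of "x - p"] inner_diff_right[of _ "x - p"] inner_commute
          power2_eq_square)
    also have "\<dots> = (norm (x - p))\<^sup>2 - (inner (x - p) s)\<^sup>2 / inner s s"
      using False by (simp add: t_def power2_eq_square)
    finally have "(inner (x - p) s)\<^sup>2 / inner s s \<le> 0" by simp
    moreover have "0 < inner s s" using False by simp
    ultimately have "(inner (x - p) s)\<^sup>2 \<le> 0" by (simp add: divide_le_0_iff)
    then show ?thesis by simp
  qed simp
  with p show thesis using that by blast
qed

lemma subspace_closure:
  fixes S :: "'a::real_normed_vector set"
  assumes "subspace S"
  shows "subspace (closure S)"
proof (rule subspaceI)
  show "0 \<in> closure S"
    using subspace_0[OF assms] closure_subset by blast
next
  fix x y assume "x \<in> closure S" "y \<in> closure S"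
  then obtain a b where "\<And>n. a n \<in> S" "a \<longlonglongrightarrow> x" "\<And>n. b n \<in> S" "b \<longlonglongrightarrow> y"
    unfolding closure_sequential by blast
  then show "x + y \<in> closure S"
    unfolding closure_sequential
    by (intro exI[of _ "\<lambda>n. a n + b n"]) (simp add: tendsto_add subspace_add[OF assms])
next
  fix r x assume "x \<in> closure S"
  then obtain a where "\<And>n. a n \<in> S" "a \<longlonglongrightarrow> x"
    unfolding closure_sequential by blast
  then show "r *\<^sub>R x \<in> closure S"
    unfolding closure_sequential
    by (intro exI[of _ "\<lambda>n. r *\<^sub>R a n"]) (simp add: tendsto_scaleR subspace_scale[OF assms])
qed

text \<open>Subtracting from \<open>\<phi> j\<close> a combination of the other vectors leaves the
  coefficient 1 at \<open>j\<close>, so the lower Riesz bound keeps the distance at least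
  \<open>sqrt A\<close>.\<close>

lemma riesz_sequence_minimal:
  assumes "riesz_sequence \<phi>"
  shows "\<phi> j \<notin> closure (span (\<phi> ` (- {j})))"
proof
  assume "\<phi> j \<in> closure (span (\<phi> ` (- {j})))"
  obtain A :: real where A: "0 < A"
    and sum: "\<And>c. summable (\<lambda>i. (c i)\<^sup>2) \<Longrightarrow> summable (\<lambda>i. c i *\<^sub>R \<phi> i)"
    and low: "\<And>c. summable (\<lambda>i. (c i)\<^sup>2) \<Longrightarrow>
      A * (\<Sum>i. (c i)\<^sup>2) \<le> (norm (\<Sum>i. c i *\<^sub>R \<phi> i))\<^sup>2"
    using assms unfolding riesz_sequence_def by metis
  define V where "V = {\<Sum>i. c i *\<^sub>R \<phi> i |c. summable (\<lambda>i. (c i)\<^sup>2) \<and> c j = 0}"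
  have V_I: "x \<in> V" if "x = (\<Sum>i. c i *\<^sub>R \<phi> i)" "summable (\<lambda>i. (c i)\<^sup>2)" "c j = 0" for x c
    using that unfolding V_def by blast
  have V_E: thesis if "x \<in> V"
    "\<And>c. x = (\<Sum>i. c i *\<^sub>R \<phi> i) \<Longrightarrow> summable (\<lambda>i. (c i)\<^sup>2) \<Longrightarrow> c j = 0 \<Longrightarrow> thesis" for x thesis
    using that unfolding V_def by blast
  have unit: "summable (\<lambda>i. (if i = k then 1 else 0 :: real)\<^sup>2)"
    "(\<Sum>i. (if i = k then 1 else 0 :: real) *\<^sub>R \<phi> i) = \<phi> k" for k
  proof -
    have "(\<lambda>i. (if i = k then 1 else 0 :: real)\<^sup>2) = (\<lambda>i. if i = k then 1 else 0)"
      by auto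
    then show "summable (\<lambda>i. (if i = k then 1 else 0 :: real)\<^sup>2)"
      using sums_single[of k "\<lambda>_. 1 :: real"] by (simp add: sums_iff)
    have "(\<lambda>i. (if i = k then 1 else 0 :: real) *\<^sub>R \<phi> i) = (\<lambda>i. if i = k then \<phi> i else 0)"
      by auto
    then show "(\<Sum>i. (if i = k then 1 else 0 :: real) *\<^sub>R \<phi> i) = \<phi> k"
      using sums_single[of k \<phi>] by (simp add: sums_iff)
  qed
  have "subspace V"
  proof (rule subspaceI)
    show "0 \<in> V" by (rule V_I[of _ "\<lambda>_. 0"]) simp_all
  next
    fix x y assume "x \<in> V" "y \<in> V"
    obtain a where a: "x = (\<Sum>i. a i *\<^sub>R \<phi> i)" "summable (\<lambda>i. (a i)\<^sup>2)" "a j = 0"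
      using \<open>x \<in> V\<close> by (rule V_E)
    obtain b where b: "y = (\<Sum>i. b i *\<^sub>R \<phi> i)" "summable (\<lambda>i. (b i)\<^sup>2)" "b j = 0"
      using \<open>y \<in> V\<close> by (rule V_E)
    show "x + y \<in> V"
    proof (rule V_I)
      show "x + y = (\<Sum>i. (a i + b i) *\<^sub>R \<phi> i)"
        unfolding a(1) b(1) scaleR_add_left by (rule suminf_add[OF sum[OF a(2)] sum[OF b(2)]])
      show "summable (\<lambda>i. (a i + b i)\<^sup>2)"
        using a(2) b(2) by (rule square_summable_add)
    qed (simp add: a(3) b(3))
  next
    fix r x assume "x \<in> V"
    then obtain a where a: "x = (\<Sum>i. a i *\<^sub>R \<phi> i)" "summable (\<lambda>i. (a i)\<^sup>2)" "a j = 0"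
      by (rule V_E)
    show "r *\<^sub>R x \<in> V"
    proof (rule V_I)
      show "r *\<^sub>R x = (\<Sum>i. (r * a i) *\<^sub>R \<phi> i)"
        unfolding a(1) using suminf_scaleR_right[OF sum[OF a(2)], of r] by simp
      show "summable (\<lambda>i. (r * a i)\<^sup>2)"
        using a(2) by (rule square_summable_scale)
    qed (simp add: a(3))
  qed
  moreover have "\<phi> ` (- {j}) \<subseteq> V"
  proof (rule image_subsetI)
    fix k assume "k \<in> - {j}"
    then show "\<phi> k \<in> V"
      by (intro V_I[OF unit(2)[symmetric] unit(1)]) simp
  qed
  ultimately have span: "span (\<phi> ` (- {j})) \<subseteq> V" by (rule span_minimal[rotated])
  obtain s where s: "s \<in> span (\<phi> ` (- {j}))" "dist s (\<phi> j) < sqrt A"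
    using \<open>\<phi> j \<in> _\<close> A unfolding closure_approachable by (metis real_sqrt_gt_zero)
  have "s \<in> V" using span s(1) by (rule subsetD)
  then obtain c where c: "s = (\<Sum>i. c i *\<^sub>R \<phi> i)" "summable (\<lambda>i. (c i)\<^sup>2)" "c j = 0"
    by (rule V_E)
  \<comment> \<open>The coefficients of \<open>\<phi> j - s\<close>. Since \<open>c j = 0\<close>,
    the entry at \<open>j\<close> is 1, and this single term bounds the sum of squares
    below.\<close>
  define b where "b i = (if i = j then 1 else 0) + (- 1) * c i" for i
  have b: "summable (\<lambda>i. (b i)\<^sup>2)"
    unfolding b_def by (rule square_summable_add[OF unit(1) square_summable_scale[OF c(2)]])
  have "\<phi> j - s = (\<Sum>i. b i *\<^sub>R \<phi> i)"
    unfolding c(1) b_def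
    using suminf_diff[OF sum[OF unit(1)[of j]] sum[OF c(2)]]
    unfolding unit(2) by (simp add: scaleR_diff_left)
  moreover have "1 \<le> (\<Sum>i. (b i)\<^sup>2)"
    using sum_le_suminf[OF b, of "{j}"] by (simp add: b_def c(3))
  then have "A * 1 \<le> A * (\<Sum>i. (b i)\<^sup>2)"
    using A by (intro mult_left_mono) auto
  ultimately have "A \<le> (dist s (\<phi> j))\<^sup>2"
    using low[OF b] unfolding dist_norm norm_minus_commute[of s] by simp
  moreover have "(dist s (\<phi> j))\<^sup>2 < (sqrt A)\<^sup>2"
    using s(2) by (intro power_strict_mono) auto
  ultimately show False using A by simp
qed

text \<open>The witness is the residual of \<open>\<phi> j\<close> after projection onto the closed
  span of the others. It is nonzero by minimality, and its inner product with
  \<open>\<phi> j\<close> is its own squared norm because it is orthogonal to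
  \<open>p\<close>.\<close>

lemma riesz_sequence_dual_vector:
  assumes "riesz_sequence \<phi>"
  obtains \<psi> where "inner \<psi> (\<phi> j) \<noteq> 0" "\<And>k. k \<noteq> j \<Longrightarrow> inner \<psi> (\<phi> k) = 0"
proof -
  define S where "S = closure (span (\<phi> ` (- {j})))"
  have "subspace S" "closed S"
    unfolding S_def by (simp_all add: subspace_closure)
  then obtain p where p: "p \<in> S" and orth: "\<And>s. s \<in> S \<Longrightarrow> inner (\<phi> j - p) s = 0"
    using orthogonal_projection_exists by metis
  show thesis
  proof (rule that)
    have "\<phi> j - p \<noteq> 0"
      using riesz_sequence_minimal[OF assms, of j] p by (auto simp: S_def)
    then have "inner (\<phi> j - p) (\<phi> j - p) \<noteq> 0" by simp
    then show "inner (\<phi> j - p) (\<phi> j) \<noteq> 0"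
      using orth[OF p] by (simp only: inner_diff_right[of "\<phi> j - p"])
    show "inner (\<phi> j - p) (\<phi> k) = 0" if "k \<noteq> j" for k
      using that by (intro orth) (auto simp: S_def intro!: closure_subset[THEN subsetD] span_base)
  qed
qed

lemma norm_retrieval_orthogonal:
  assumes "norm_retrieval \<phi>"
    and \<psi>: "\<And>k. k \<noteq> j \<Longrightarrow> inner \<psi> (\<phi> k) = 0"
    and u: "inner u (\<phi> j) = 0"
  shows "inner u \<psi> = 0"
proof -
  \<comment> \<open>At \<open>k = j\<close> the contribution of \<open>u\<close> vanishes, elsewhere
    that of \<open>\<psi>\<close>, so the two measurements agree up to sign.\<close>
  have "\<bar>inner (u + \<psi>) (\<phi> k)\<bar> = \<bar>inner (u - \<psi>) (\<phi> k)\<bar>" for k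
    using \<psi>[of k] u by (cases "k = j") (auto simp: inner_add_left inner_diff_left)
  then have "norm (u + \<psi>) = norm (u - \<psi>)"
    using assms(1) unfolding norm_retrieval_def by blast
  then have "(norm (u + \<psi>))\<^sup>2 = (norm (u - \<psi>))\<^sup>2" by simp
  \<comment> \<open>Polarization: the two squared norms differ by four times
    \<open>inner u \<psi>\<close>.\<close>
  then show ?thesis
    unfolding power2_norm_eq_inner
    by (simp add: inner_add_left inner_add_right inner_diff_left inner_diff_right inner_commute)
qed

theorem proposition1:
  fixes \<phi> :: "nat \<Rightarrow> ell2"
  assumes "riesz_basis \<phi>"
    and "norm_retrieval \<phi>"
  shows "\<forall>i j. i \<noteq> j \<longrightarrow> inner (\<phi> i) (\<phi> j) = 0"
proof (intro allI impI)
  fix i j :: nat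
  assume "i \<noteq> j"
  obtain \<psi> where \<psi>i: "inner \<psi> (\<phi> i) \<noteq> 0" and \<psi>: "\<And>k. k \<noteq> i \<Longrightarrow> inner \<psi> (\<phi> k) = 0"
    using riesz_sequence_dual_vector assms(1) unfolding riesz_basis_def by metis
  \<comment> \<open>The projection coefficient of \<open>\<psi>\<close> on \<open>\<phi> i\<close>,
    chosen to make \<open>u\<close> orthogonal to \<open>\<phi> i\<close>.\<close>
  define t where "t = inner \<psi> (\<phi> i) / inner (\<phi> i) (\<phi> i)"
  define u where "u = \<psi> - t *\<^sub>R \<phi> i"
  have "\<phi> i \<noteq> 0" using \<psi>i by auto
  then have u: "inner u (\<phi> i) = 0" by (simp add: u_def t_def inner_diff_left)
  then have "inner u \<psi> = 0"
    using norm_retrieval_orthogonal[OF assms(2)] \<psi> by blast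
  \<comment> \<open>Expanding only the second factor writes it through \<open>\<psi>\<close> and
    \<open>\<phi> i\<close>, both orthogonal to \<open>u\<close>.\<close>
  with u have "inner u u = 0"
    by (subst (2) u_def) (simp add: inner_diff_right)
  then have \<psi>_eq: "\<psi> = t *\<^sub>R \<phi> i" by (simp add: u_def)
  \<comment> \<open>With \<open>t\<close> nonzero, \<open>\<phi> i\<close> inherits from
    \<open>\<psi>\<close> the orthogonality to \<open>\<phi> j\<close>.\<close>
  with \<psi>i have "t \<noteq> 0" by auto
  moreover have "t * inner (\<phi> i) (\<phi> j) = 0"
    using \<psi>[of j] \<open>i \<noteq> j\<close> by (simp add: \<psi>_eq)
  ultimately show "inner (\<phi> i) (\<phi> j) = 0" by simp
qed

end
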